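(* For $r\ge 2$ and $n\ge r$, \[W_n^{(r)}(x,y)=x\sum_{i=1}^{r-1}(n-1)_{i-1}\,W_{n-i}^{(r)}(x,y)+(y+n-r)(n-1)_{r-1}\,W_{n-r}^{(r)}(x,y),\] where $W_n^{(r)}(x,y)=x^{(n)}$ for $0\le n\le r-1$.
   Context: Fix an integer $r\ge 2$. A cycle of a permutation is $r$-regular if its length is not divisible by $r$, and $r$-singular if its length is divisible by $r$. For $\sigma\in S_n$ (permutations of $\{1,\dots,n\}$), let $r(\sigma)$ and $s(\sigma)$ be the numbers of $r$-regular and $r$-singular cycles of $\sigma$. Define $W_0^{(r)}(x,y)=1$ and $W_n^{(r)}(x,y)=\sum_{\sigma\in S_n}x^{r(\sigma)}y^{s(\sigma)}$ for $n\ge1$. Notation: $(m)_0=1$, $(m)_k=m(m-1)\cdots(m-k+1)$; $x^{(0)}=1$, $x^{(n)}=x(x+1)\cdots(x+n-1)$. *)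

theory Defs
  imports Complex_Main "HOL-Combinatorics.Orbits"
begin

text \<open>
  A cycle of a permutation is represented by its underlying set, which is an orbit; its length
  is the cardinality of that set. Fixed points count as cycles of length 1, so the orbits are
  taken over the whole ground set and not only over the moved points.
\<close>

definition cycles_on :: "nat set \<Rightarrow> (nat \<Rightarrow> nat) \<Rightarrow> nat set set" where
  "cycles_on A \<sigma> = orbit \<sigma> ` A"

definition regular_cycles :: "nat \<Rightarrow> nat set \<Rightarrow> (nat \<Rightarrow> nat) \<Rightarrow> nat" where
  "regular_cycles r A \<sigma> = card {C \<in> cycles_on A \<sigma>. \<not> r dvd card C}"

definition singular_cycles :: "nat \<Rightarrow> nat set \<Rightarrow> (nat \<Rightarrow> nat) \<Rightarrow> nat" where
  "singular_cycles r A \<sigma> = card {C \<in> cycles_on A \<sigma>. r dvd card C}"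

text \<open>
  The polynomial is rendered by its values at arbitrary elements of an arbitrary commutative ring;
  this includes the case where the two arguments are the indeterminates of a polynomial ring.
\<close>

definition W :: "nat \<Rightarrow> nat \<Rightarrow> 'a::comm_ring_1 \<Rightarrow> 'a \<Rightarrow> 'a" where
  "W r n x y =
     (if n = 0 then 1
      else (\<Sum>\<sigma> | \<sigma> permutes {1..n}.
              x ^ regular_cycles r {1..n} \<sigma> * y ^ singular_cycles r {1..n} \<sigma>))"

text \<open>
  Falling factorial. Truncated subtraction is harmless: if \<open>k > m\<close>, the factor for \<open>j = m\<close> is 0.
\<close>

definition falling_fact :: "nat \<Rightarrow> nat \<Rightarrow> nat" where
  "falling_fact m k = (\<Prod>j<k. m - j)"

end

theory Submission
  imports Defs
begin

text \<open>
  Splitting off the cycle through a chosen element \<open>a\<close> of the ground set gives the full recurrence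
  \<open>W\<^sub>n = \<Sum>k=1..n. (n-1)\<^sub>k\<^sub>-\<^sub>1 z\<^sub>k W\<^sub>n\<^sub>-\<^sub>k\<close>, where \<open>z\<^sub>k\<close> is \<open>y\<close> if \<open>r\<close> divides \<open>k\<close> and \<open>x\<close> otherwise.
  Since \<open>z\<close> has period \<open>r\<close> and \<open>(n-1)\<^sub>r\<^sub>+\<^sub>j\<^sub>-\<^sub>1 = (n-1)\<^sub>r (n-r-1)\<^sub>j\<^sub>-\<^sub>1\<close>, the terms with \<open>k > r\<close> add up
  to \<open>(n-1)\<^sub>r W\<^sub>n\<^sub>-\<^sub>r\<close>. For \<open>n < r\<close> only the value \<open>x\<close> of \<open>z\<close> occurs, so the same argument
  applies with period 1 and gives \<open>W\<^sub>n = (x + n - 1) W\<^sub>n\<^sub>-\<^sub>1\<close>.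
\<close>

section \<open>Splitting a permutation at the cycle through one element\<close>

text \<open>Arbitrary ground sets are needed because removing a cycle from \<open>{1..n}\<close>
  seldom leaves an initial interval. Arbitrary weights allow all of them to be 1, which serves to
  count cycles.\<close>

definition cycle_sum :: "(nat \<Rightarrow> 'a::comm_semiring_1) \<Rightarrow> nat set \<Rightarrow> 'a" where
  "cycle_sum z A = (\<Sum>\<sigma> | \<sigma> permutes A. \<Prod>C\<in>cycles_on A \<sigma>. z (card C))"

definition full_cycles :: "'a set \<Rightarrow> 'a \<Rightarrow> ('a \<Rightarrow> 'a) set" where
  "full_cycles C a = {\<sigma>. \<sigma> permutes C \<and> orbit \<sigma> a = C}"

lemma finite_full_cycles: "finite C \<Longrightarrow> finite (full_cycles C a)"
  unfolding full_cycles_def using finite_permutations[of C] by (rule rev_finite_subset) auto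

lemma perm_restrict_comp_permutes:
  assumes "\<alpha> permutes C" "\<beta> permutes A - C"
  shows "perm_restrict (\<alpha> \<circ> \<beta>) C = \<alpha>" "perm_restrict (\<alpha> \<circ> \<beta>) (A - C) = \<beta>"
proof -
  have "\<beta> x = x" if "x \<in> C" for x
    using assms(2) that by (simp add: permutes_not_in)
  moreover have "\<alpha> (\<beta> x) = \<beta> x" if "x \<notin> C" for x
    using permutes_in_image[OF assms(2), of x] permutes_not_in[OF assms(2), of x] that
    by (intro permutes_not_in[OF assms(1)]) auto
  ultimately show "perm_restrict (\<alpha> \<circ> \<beta>) C = \<alpha>" "perm_restrict (\<alpha> \<circ> \<beta>) (A - C) = \<beta>"
    using permutes_not_in[OF assms(1)] permutes_not_in[OF assms(2)]
    by (auto simp: perm_restrict_def)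
qed

lemma comp_permutes_Diff:
  assumes "\<alpha> permutes C" "\<beta> permutes A - C" "C \<subseteq> A"
  shows "\<alpha> \<circ> \<beta> permutes A"
  by (intro permutes_compose permutes_subset[OF assms(2)] permutes_subset[OF assms(1,3)]) auto

text \<open>Both \<open>C\<close> and \<open>A - C\<close> are invariant, and on each the composite
  agrees with one of the factors.\<close>

lemma orbit_comp_permutes:
  assumes "\<alpha> permutes C" "\<beta> permutes A - C"
  shows "x \<in> C \<Longrightarrow> orbit (\<alpha> \<circ> \<beta>) x = orbit \<alpha> x"
    and "x \<in> A - C \<Longrightarrow> orbit (\<alpha> \<circ> \<beta>) x = orbit \<beta> x"
proof -
  note r = perm_restrict_comp_permutes[OF assms]
  show "orbit (\<alpha> \<circ> \<beta>) x = orbit \<alpha> x" if "x \<in> C"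
  proof (rule orbit_cong0[OF that, symmetric])
    show "\<alpha> \<in> C \<rightarrow> C" using assms by (auto simp: permutes_in_image)
    show "\<alpha> y = (\<alpha> \<circ> \<beta>) y" if "y \<in> C" for y
      using perm_restrict_simps(1)[OF that, of "\<alpha> \<circ> \<beta>"] r by simp
  qed
  show "orbit (\<alpha> \<circ> \<beta>) x = orbit \<beta> x" if "x \<in> A - C"
  proof (rule orbit_cong0[OF that, symmetric])
    show "\<beta> \<in> A - C \<rightarrow> A - C" by (auto simp only: Pi_iff permutes_in_image[OF assms(2)])
    show "\<beta> y = (\<alpha> \<circ> \<beta>) y" if "y \<in> A - C" for y
      using perm_restrict_simps(1)[OF that, of "\<alpha> \<circ> \<beta>"] r by simp
  qed
qed

text \<open>The inverse restricts \<open>\<sigma>\<close> to its cycle \<open>C\<close> and to the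
  complement \<open>A - C\<close>.\<close>

lemma bij_betw_split_orbit:
  assumes "finite A" "a \<in> C" "C \<subseteq> A"
  shows "bij_betw (\<lambda>(\<alpha>, \<beta>). \<alpha> \<circ> \<beta>) (full_cycles C a \<times> {\<beta>. \<beta> permutes A - C})
           {\<sigma>. \<sigma> permutes A \<and> orbit \<sigma> a = C}"
proof (rule bij_betw_byWitness[where f' = "\<lambda>\<sigma>. (perm_restrict \<sigma> C, perm_restrict \<sigma> (A - C))"])
  show "(\<lambda>\<sigma>. (perm_restrict \<sigma> C, perm_restrict \<sigma> (A - C))) ` {\<sigma>. \<sigma> permutes A \<and> orbit \<sigma> a = C}
          \<subseteq> full_cycles C a \<times> {\<beta>. \<beta> permutes A - C}"
  proof clarsimp
    fix \<sigma> assume s: "\<sigma> permutes A" "C = orbit \<sigma> a"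
    have cyc: "cyclic_on \<sigma> C" unfolding s by (rule cyclic_on_orbit[OF s(1) assms(1)])
    have "bij_betw \<sigma> C C"
    proof -
      have "\<sigma> ` C \<subseteq> C" using cyclic_on_inI[OF cyc] by auto
      moreover have "inj_on \<sigma> C" using s(1) permutes_inj_on by blast
      ultimately show ?thesis
        using finite_cyclic_on[OF cyc] by (metis bij_betw_def endo_inj_surj)
    qed
    then have "perm_restrict \<sigma> C permutes C"
      by (intro bij_imp_permutes) (auto simp: perm_restrict_def cong: bij_betw_cong)
    moreover have "orbit (perm_restrict \<sigma> C) a = C"
      using cyc assms(2) by (meson cyclic_on_perm_restrict orbit_cyclic_eq3)
    ultimately show "perm_restrict \<sigma> (orbit \<sigma> a) \<in> full_cycles (orbit \<sigma> a) a \<and>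
        perm_restrict \<sigma> (A - orbit \<sigma> a) permutes A - orbit \<sigma> a"
      using perm_restrict_diff_cyclic[OF s(1) cyc] s(2) by (simp add: full_cycles_def)
  qed
  show "\<forall>\<sigma>\<in>{\<sigma>. \<sigma> permutes A \<and> orbit \<sigma> a = C}.
      (\<lambda>(\<alpha>, \<beta>). \<alpha> \<circ> \<beta>) (perm_restrict \<sigma> C, perm_restrict \<sigma> (A - C)) = \<sigma>"
  proof clarsimp
    fix \<sigma> assume s: "\<sigma> permutes A" "C = orbit \<sigma> a"
    have cyc: "cyclic_on \<sigma> C" unfolding s by (rule cyclic_on_orbit[OF s(1) assms(1)])
    show "perm_restrict \<sigma> (orbit \<sigma> a) \<circ> perm_restrict \<sigma> (A - orbit \<sigma> a) = \<sigma>"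
    proof
      fix x
      show "(perm_restrict \<sigma> (orbit \<sigma> a) \<circ> perm_restrict \<sigma> (A - orbit \<sigma> a)) x = \<sigma> x"
        \<comment> \<open>As \<open>\<sigma> x\<close> lies in the cycle exactly when
          \<open>x\<close> does, at most one factor moves \<open>x\<close>, and that factor acts as
          \<open>\<sigma>\<close>.\<close>
        using cyclic_on_f_in[OF s(1) cyc, of x] s
        by (auto simp: perm_restrict_def permutes_not_in)
    qed
  qed
next
  show "\<forall>p\<in>full_cycles C a \<times> {\<beta>. \<beta> permutes A - C}.
      (\<lambda>\<sigma>. (perm_restrict \<sigma> C, perm_restrict \<sigma> (A - C))) ((\<lambda>(\<alpha>, \<beta>). \<alpha> \<circ> \<beta>) p) = p"
    by (auto simp: full_cycles_def perm_restrict_comp_permutes simp del: o_apply)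
  show "(\<lambda>(\<alpha>, \<beta>). \<alpha> \<circ> \<beta>) ` (full_cycles C a \<times> {\<beta>. \<beta> permutes A - C})
          \<subseteq> {\<sigma>. \<sigma> permutes A \<and> orbit \<sigma> a = C}"
    using comp_permutes_Diff[OF _ _ assms(3)] orbit_comp_permutes(1)[OF _ _ assms(2)]
    by (auto simp: full_cycles_def)
qed

lemma prod_cycles_comp:
  assumes "finite A" "a \<in> C" "C \<subseteq> A" "\<alpha> \<in> full_cycles C a" "\<beta> permutes A - C"
  shows "(\<Prod>D\<in>cycles_on A (\<alpha> \<circ> \<beta>). z (card D)) = z (card C) * (\<Prod>D\<in>cycles_on (A - C) \<beta>. z (card D))"
proof -
  have \<alpha>: "\<alpha> permutes C" "orbit \<alpha> a = C" using assms(4) by (auto simp: full_cycles_def)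
  have "orbit \<alpha> x = C" if "x \<in> C" for x
    using that \<alpha> assms by (metis cyclic_on_def orbit_cyclic_eq3)
  then have "orbit (\<alpha> \<circ> \<beta>) ` C = {C}"
    using orbit_comp_permutes(1)[OF \<alpha>(1) assms(5)] assms(2) by auto
  moreover have "orbit (\<alpha> \<circ> \<beta>) ` (A - C) = orbit \<beta> ` (A - C)"
    using orbit_comp_permutes(2)[OF \<alpha>(1) assms(5)] by (intro image_cong) auto
  moreover have "A = C \<union> (A - C)" using assms by auto
  ultimately have "cycles_on A (\<alpha> \<circ> \<beta>) = insert C (cycles_on (A - C) \<beta>)"
    unfolding cycles_on_def by (metis image_Un insert_is_Un)
  \<comment> \<open>Cycles form a set, so \<open>C\<close> contributes its own factor only if it is
    new. It is, since orbits of \<open>\<beta>\<close> stay in \<open>A - C\<close> while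
    \<open>a\<close> is in \<open>C\<close>.\<close>
  moreover have "C \<notin> cycles_on (A - C) \<beta>"
    using permutes_orbit_subset[OF assms(5)] assms(2) unfolding cycles_on_def by blast
  moreover have "finite (cycles_on (A - C) \<beta>)"
    using assms(1) by (simp add: cycles_on_def)
  ultimately show ?thesis by simp
qed

text \<open>Permutations are grouped by the orbit of \<open>a\<close>. The weight of
  \<open>\<alpha> \<circ> \<beta>\<close> does not depend on which full cycle
  \<open>\<alpha>\<close> is, so only their number enters.\<close>

lemma cycle_sum_split:
  assumes "finite A" "a \<in> A"
  shows "cycle_sum z A =
    (\<Sum>C | C \<subseteq> A \<and> a \<in> C. of_nat (card (full_cycles C a)) * z (card C) * cycle_sum z (A - C))"
proof -
  let ?f = "\<lambda>\<sigma>. \<Prod>D\<in>cycles_on A \<sigma>. z (card D)"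
  have "cycle_sum z A = (\<Sum>C | C \<subseteq> A \<and> a \<in> C. \<Sum>\<sigma> | \<sigma> \<in> {\<sigma>. \<sigma> permutes A} \<and> orbit \<sigma> a = C. ?f \<sigma>)"
    unfolding cycle_sum_def
  proof (rule sum.group[symmetric])
    show "(\<lambda>\<sigma>. orbit \<sigma> a) ` {\<sigma>. \<sigma> permutes A} \<subseteq> {C. C \<subseteq> A \<and> a \<in> C}"
    proof (intro image_subsetI CollectI conjI; drule CollectD)
      fix \<sigma> assume s: "\<sigma> permutes A"
      show "orbit \<sigma> a \<subseteq> A" by (rule permutes_orbit_subset[OF s assms(2)])
      show "a \<in> orbit \<sigma> a"
        using permutes_imp_permutation[OF assms(1) s] by (rule permutation_self_in_orbit)
    qed
  qed (use assms in \<open>auto simp: finite_permutations\<close>)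
  also have "\<dots> = (\<Sum>C | C \<subseteq> A \<and> a \<in> C.
      of_nat (card (full_cycles C a)) * z (card C) * cycle_sum z (A - C))"
  proof (rule sum.cong[OF refl], clarify)
    fix C assume C: "C \<subseteq> A" "a \<in> C"
    have "(\<Sum>\<sigma> | \<sigma> \<in> {\<sigma>. \<sigma> permutes A} \<and> orbit \<sigma> a = C. ?f \<sigma>)
        = (\<Sum>(\<alpha>, \<beta>)\<in>full_cycles C a \<times> {\<beta>. \<beta> permutes A - C}. ?f (\<alpha> \<circ> \<beta>))"
      using sum.reindex_bij_betw[OF bij_betw_split_orbit[OF assms(1) C(2,1)], of ?f]
      by (simp add: case_prod_beta)
    also have "\<dots> = (\<Sum>(\<alpha>, \<beta>)\<in>full_cycles C a \<times> {\<beta>. \<beta> permutes A - C}.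
        z (card C) * (\<Prod>D\<in>cycles_on (A - C) \<beta>. z (card D)))"
      using C assms by (intro sum.cong) (auto simp: prod_cycles_comp)
    also have "\<dots> = of_nat (card (full_cycles C a)) * z (card C) * cycle_sum z (A - C)"
      by (simp add: sum.cartesian_product[symmetric] cycle_sum_def sum_distrib_left mult.assoc)
    finally show "(\<Sum>\<sigma> | \<sigma> \<in> {\<sigma>. \<sigma> permutes A} \<and> orbit \<sigma> a = C. ?f \<sigma>) =
      of_nat (card (full_cycles C a)) * z (card C) * cycle_sum z (A - C)" .
  qed
  finally show ?thesis .
qed

section \<open>Falling factorials, subsets by size, and the number of full cycles\<close>

lemma falling_fact_fact: "k \<le> m \<Longrightarrow> falling_fact m k * fact (m - k) = fact m"
proof (induction k)
  case (Suc k)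
  then have "fact (m - k) = (m - k) * fact (m - Suc k)"
    by (metis Suc_diff_Suc Suc_le_lessD diff_Suc_1 fact_reduce of_nat_id zero_less_diff)
  with Suc show ?case by (simp add: falling_fact_def mult_ac)
qed (simp add: falling_fact_def)

lemma binomial_fact_eq_falling_fact:
  assumes "k \<le> m"
  shows "(m choose k) * fact k = falling_fact m k"
proof -
  have "((m choose k) * fact k) * fact (m - k) = falling_fact m k * fact (m - k)"
    using binomial_fact_lemma[OF assms] falling_fact_fact[OF assms] by (simp add: mult_ac)
  then show ?thesis by simp
qed

text \<open>This holds even for truncated subtraction, where \<open>m - (j + i) = m - j - i\<close>
  as well.\<close>

lemma falling_fact_add: "falling_fact m (j + k) = falling_fact m j * falling_fact (m - j) k"
  by (induction k) (simp_all add: falling_fact_def)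

text \<open>Subsets of size \<open>k\<close> containing \<open>a\<close> arise by inserting
  \<open>a\<close> into subsets of \<open>A - {a}\<close> of size \<open>k - 1\<close>.\<close>

lemma sum_subsets_containing:
  fixes g :: "nat \<Rightarrow> 'b::comm_semiring_1"
  assumes "finite A" "a \<in> A"
  shows "(\<Sum>C | C \<subseteq> A \<and> a \<in> C. g (card C))
       = (\<Sum>k = 1..card A. of_nat ((card A - 1) choose (k - 1)) * g k)"
proof -
  let ?S = "{C. C \<subseteq> A \<and> a \<in> C}"
  have "(\<Sum>C\<in>?S. g (card C)) = (\<Sum>k = 1..card A. \<Sum>C | C \<in> ?S \<and> card C = k. g (card C))"
  proof (rule sum.group[symmetric])
    show "card ` ?S \<subseteq> {1..card A}"
      using assms by (auto simp: card_mono Suc_le_eq card_gt_0_iff rev_finite_subset)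
  qed (use assms in auto)
  also have "\<dots> = (\<Sum>k = 1..card A. of_nat ((card A - 1) choose (k - 1)) * g k)"
  proof (rule sum.cong[OF refl])
    fix k assume k: "k \<in> {1..card A}"
    have "bij_betw (insert a) {D. D \<subseteq> A - {a} \<and> card D = k - 1} {C. C \<in> ?S \<and> card C = k}"
    proof (rule bij_betw_byWitness[where f' = "\<lambda>C. C - {a}"])
      show "insert a ` {D. D \<subseteq> A - {a} \<and> card D = k - 1} \<subseteq> {C. C \<in> ?S \<and> card C = k}"
      proof (intro image_subsetI CollectI conjI)
        fix D assume "D \<in> {D. D \<subseteq> A - {a} \<and> card D = k - 1}"
        then have D: "D \<subseteq> A" "a \<notin> D" "card D = k - 1" by auto
        moreover have "finite D" using D assms by (auto intro: finite_subset)
        ultimately show "insert a D \<subseteq> A" "a \<in> insert a D" "card (insert a D) = k"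
          using k assms by auto
      qed
    qed (use assms k in \<open>auto simp: insert_absorb card_Diff_singleton\<close>)
    then have "card {C. C \<in> ?S \<and> card C = k} = (card A - 1) choose (k - 1)"
      using n_subsets[of "A - {a}" "k - 1"] assms by (simp add: bij_betw_same_card[symmetric])
    then show "(\<Sum>C | C \<in> ?S \<and> card C = k. g (card C)) = of_nat ((card A - 1) choose (k - 1)) * g k"
      by simp
  qed
  finally show ?thesis .
qed

text \<open>
  No cycles need to be constructed: putting all weights equal to 1 in the splitting identity gives
  \<open>n! = \<Sum>k=1..n. (n-1 choose k-1) c\<^sub>k (n-k)!\<close>, which determines \<open>c\<^sub>n\<close> from the \<open>c\<^sub>k\<close> with \<open>k < n\<close>.
\<close>

lemma card_full_cycles:
  fixes C :: "nat set"
  assumes "finite C" "a \<in> C"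
  shows "card (full_cycles C a) = fact (card C - 1)"
  using assms
proof (induction "card C" arbitrary: C rule: less_induct)
  case less
  define n where "n = card C"
  have n: "n \<ge> 1" using less.prems by (auto simp: n_def Suc_le_eq card_gt_0_iff)
  have cs1: "cycle_sum (\<lambda>_. 1::nat) B = fact (card B)" if "finite B" for B
    using that by (simp add: cycle_sum_def card_permutations)
  let ?S = "{D. D \<subseteq> C \<and> a \<in> D}"
  \<comment> \<open>The induction hypothesis gives the values for \<open>k < n\<close>. The value 0
    at \<open>k = n\<close> lets the sum over proper subsets run over all of \<open>?S\<close>,
    where it can be regrouped by size.\<close>
  let ?g = "\<lambda>k. (if k = n then 0 else fact (k - 1) * fact (n - k)) :: nat"
  have fin: "finite ?S" using less.prems by simp
  have "fact n = (\<Sum>D\<in>?S. card (full_cycles D a) * fact (card (C - D)))"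
    using cycle_sum_split[OF less.prems, of "\<lambda>_. 1::nat"] less.prems
    by (simp add: cs1 n_def del: One_nat_def)
  also have "\<dots> = card (full_cycles C a) + (\<Sum>D\<in>?S - {C}. card (full_cycles D a) * fact (card (C - D)))"
    using fin less.prems by (subst sum.remove[of _ C]) auto
  also have "(\<Sum>D\<in>?S - {C}. card (full_cycles D a) * fact (card (C - D))) = (\<Sum>D\<in>?S - {C}. ?g (card D))"
  proof (rule sum.cong[OF refl])
    fix D assume D: "D \<in> ?S - {C}"
    then have "card D < card C" "finite D"
      using less.prems by (auto intro: psubset_card_mono finite_subset)
    with D less show "card (full_cycles D a) * fact (card (C - D)) = ?g (card D)"
      by (simp add: n_def card_Diff_subset)
  qed
  also have "\<dots> = (\<Sum>D\<in>?S. ?g (card D))"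
    using fin less.prems by (intro sum.mono_neutral_left) (auto simp: n_def)
  also have "\<dots> = (\<Sum>k = 1..n. ((n - 1) choose (k - 1)) * ?g k)"
    using sum_subsets_containing[OF less.prems, of ?g] by (simp add: n_def)
  also have "\<dots> = (\<Sum>k = 1..<n. ((n - 1) choose (k - 1)) * ?g k)"
    by (intro sum.mono_neutral_right) auto
  also have "\<dots> = (\<Sum>k = 1..<n. fact (n - 1))"
  proof (rule sum.cong[OF refl])
    fix k assume k: "k \<in> {1..<n}"
    then have "fact (k - 1) * fact ((n - 1) - (k - 1)) * ((n - 1) choose (k - 1)) = fact (n - 1)"
      by (intro binomial_fact_lemma) auto
    with k show "((n - 1) choose (k - 1)) * ?g k = fact (n - 1)" by (simp add: mult_ac)
  qed
  also have "\<dots> = (n - 1) * fact (n - 1)" by simp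
  finally have "fact n = card (full_cycles C a) + (n - 1) * fact (n - 1)" .
  moreover have "fact n = n * (fact (n - 1) :: nat)" using n by (simp add: fact_reduce)
  ultimately show ?case using n by (cases n) (simp_all flip: n_def)
qed

section \<open>The recurrence for cycle sums\<close>

text \<open>Dependence on size alone is assumed only below \<open>card A\<close>, so that the
  recurrence is available inside the induction proving it in general.\<close>

lemma cycle_sum_rec_aux:
  assumes "finite A" "A \<noteq> {}"
    and "\<And>B. finite B \<Longrightarrow> card B < card A \<Longrightarrow> cycle_sum z B = cycle_sum z {1..card B}"
  shows "cycle_sum z A = (\<Sum>k = 1..card A.
    of_nat (falling_fact (card A - 1) (k - 1)) * z k * cycle_sum z {1..card A - k})"
proof -
  from assms obtain a where a: "a \<in> A" by blast
  let ?g = "\<lambda>k. of_nat (fact (k - 1)) * z k * cycle_sum z {1..card A - k}"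
  have "cycle_sum z A = (\<Sum>C | C \<subseteq> A \<and> a \<in> C. ?g (card C))"
    unfolding cycle_sum_split[OF assms(1) a]
  proof (rule sum.cong[OF refl], clarify)
    fix C assume C: "C \<subseteq> A" "a \<in> C"
    have fC: "finite C" using C assms by (auto intro: finite_subset)
    have "card (A - C) < card A" using C assms a by (intro psubset_card_mono) auto
    then have "cycle_sum z (A - C) = cycle_sum z {1..card A - card C}"
      using assms(1) assms(3)[of "A - C"] C fC by (simp add: card_Diff_subset)
    then show "of_nat (card (full_cycles C a)) * z (card C) * cycle_sum z (A - C) = ?g (card C)"
      using card_full_cycles[OF fC C(2)] by simp
  qed
  also have "\<dots> = (\<Sum>k = 1..card A. of_nat ((card A - 1) choose (k - 1)) * ?g k)"
    by (rule sum_subsets_containing[OF assms(1) a])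
  also have "\<dots> = (\<Sum>k = 1..card A.
    of_nat (falling_fact (card A - 1) (k - 1)) * z k * cycle_sum z {1..card A - k})"
    by (intro sum.cong refl)
      (auto simp: mult.assoc simp flip: binomial_fact_eq_falling_fact)
  finally show ?thesis .
qed

text \<open>No relabelling of elements: \<open>A\<close> and \<open>{1..card A}\<close> satisfy the
  same recurrence, whose right-hand side involves only \<open>card A\<close>.\<close>

lemma cycle_sum_card:
  "finite A \<Longrightarrow> cycle_sum z A = cycle_sum z {1..card A}"
proof (induction "card A" arbitrary: A rule: less_induct)
  case less
  show ?case
  proof (cases "A = {}")
    case False
    with less.prems have ne: "{1..card A} \<noteq> {}" by (simp add: Suc_le_eq card_gt_0_iff)
    have IH: "cycle_sum z B = cycle_sum z {1..card B}" if "finite B" "card B < card A" for B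
      using less.hyps that by blast
    note cycle_sum_rec_aux[OF less.prems False IH]
    also note cycle_sum_rec_aux[OF finite_atLeastAtMost ne, of z,
        unfolded card_atLeastAtMost diff_Suc_1, OF IH, symmetric]
    finally show ?thesis .
  qed simp
qed

lemma cycle_sum_rec:
  assumes "n \<ge> 1"
  shows "cycle_sum z {1..n} = (\<Sum>k = 1..n.
    of_nat (falling_fact (n - 1) (k - 1)) * z k * cycle_sum z {1..n - k})"
  using cycle_sum_rec_aux[of "{1..n}" z, OF _ _ cycle_sum_card] assms by simp

lemma cycle_sum_empty: "cycle_sum z {} = 1"
  by (simp add: cycle_sum_def cycles_on_def)

text \<open>Periodicity is asked only within \<open>1..n\<close>. This admits both
  \<open>s = r\<close> and, for \<open>n < r\<close>, \<open>s = 1\<close>.\<close>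

lemma cycle_sum_rec_periodic:
  assumes "s \<ge> 1" "s \<le> n" and per: "\<And>k. 1 \<le> k \<Longrightarrow> k \<le> n - s \<Longrightarrow> z (s + k) = z k"
  shows "cycle_sum z {1..n} =
    (\<Sum>k = 1..s. of_nat (falling_fact (n - 1) (k - 1)) * z k * cycle_sum z {1..n - k})
    + of_nat (falling_fact (n - 1) s) * cycle_sum z {1..n - s}"
proof -
  let ?t = "\<lambda>n k. of_nat (falling_fact (n - 1) (k - 1)) * z k * cycle_sum z {1..n - k}"
  have "cycle_sum z {1..n} = (\<Sum>k = 1..s + (n - s). ?t n k)"
    using cycle_sum_rec[of n z] assms by simp
  also have "\<dots> = (\<Sum>k = 1..s. ?t n k) + (\<Sum>k = s + 1..s + (n - s). ?t n k)"
    by (rule sum.ub_add_nat) simp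
  also have "(\<Sum>k = s + 1..s + (n - s). ?t n k) = (\<Sum>k = 1..n - s. ?t n (s + k))"
    using sum.shift_bounds_cl_nat_ivl[of "?t n" 1 s "n - s"] by (simp add: add.commute)
  also have "\<dots> = (\<Sum>k = 1..n - s. of_nat (falling_fact (n - 1) s) * ?t (n - s) k)"
  proof (rule sum.cong[OF refl])
    fix k assume k: "k \<in> {1..n - s}"
    have "falling_fact (n - 1) (s + k - 1)
        = falling_fact (n - 1) s * falling_fact (n - s - 1) (k - 1)"
      using k falling_fact_add[of "n - 1" s "k - 1"] by (simp add: diff_right_commute)
    with k per[of k] show "?t n (s + k) = of_nat (falling_fact (n - 1) s) * ?t (n - s) k"
      by (simp add: mult_ac)
  qed
  also have "\<dots> = of_nat (falling_fact (n - 1) s) * cycle_sum z {1..n - s}"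
  proof (cases "s = n")
    \<comment> \<open>The recurrence does not cover size 0; here the falling factorial vanishes
      through its factor at \<open>j = n - 1\<close>.\<close>
    case True
    then have "falling_fact (n - 1) s = 0"
      using assms by (auto simp: falling_fact_def intro!: bexI[of _ "n - 1"])
    then show ?thesis using True by simp
  next
    case False
    then show ?thesis
      using cycle_sum_rec[of "n - s" z] assms by (simp add: sum_distrib_left)
  qed
  finally show ?thesis .
qed

text \<open>Separating the cycles by divisibility of their length turns the product of weights into
  the two powers.\<close>

lemma W_eq_cycle_sum: "W r n x y = cycle_sum (\<lambda>k. if r dvd k then y else x) {1..n}"
proof (cases "n = 0")
  case True
  then show ?thesis by (simp add: W_def cycle_sum_empty)
next
  case False
  have "x ^ regular_cycles r {1..n} \<sigma> * y ^ singular_cycles r {1..n} \<sigma>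
      = (\<Prod>C\<in>cycles_on {1..n} \<sigma>. if r dvd card C then y else x)" for \<sigma>
    by (simp add: regular_cycles_def singular_cycles_def prod.If_cases cycles_on_def
        Int_def mult.commute)
  with False show ?thesis by (simp add: W_def cycle_sum_def)
qed

theorem theorem3p1:
  fixes r n :: nat and x y :: "'a::comm_ring_1"
  assumes "r \<ge> 2" and "n \<ge> r"
  shows "W r n x y =
           x * (\<Sum>i = 1..r - 1. of_nat (falling_fact (n - 1) (i - 1)) * W r (n - i) x y)
           + (y + of_nat n - of_nat r) * of_nat (falling_fact (n - 1) (r - 1)) * W r (n - r) x y
         \<and> (\<forall>m \<le> r - 1. W r m x y = pochhammer x m)"
proof
  define z where "z = (\<lambda>k. if r dvd k then y else x)"
  have W: "W r m x y = cycle_sum z {1..m}" for m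
    by (simp add: W_eq_cycle_sum z_def)
  have z: "z k = x" if "1 \<le> k" "k \<le> r - 1" for k
    using that assms by (auto simp: z_def dest: dvd_imp_le)
  let ?t = "\<lambda>k. of_nat (falling_fact (n - 1) (k - 1)) * z k * W r (n - k) x y"
  have "{1..r} = insert r {1..r - 1}" using assms by auto
  then have "(\<Sum>k = 1..r. ?t k) = ?t r + (\<Sum>k = 1..r - 1. ?t k)" using assms by simp
  also have "(\<Sum>k = 1..r - 1. ?t k)
      = x * (\<Sum>k = 1..r - 1. of_nat (falling_fact (n - 1) (k - 1)) * W r (n - k) x y)"
    unfolding sum_distrib_left by (intro sum.cong refl) (use z in \<open>simp add: mult_ac\<close>)
  finally have 1: "(\<Sum>k = 1..r. ?t k) = of_nat (falling_fact (n - 1) (r - 1)) * y * W r (n - r) x y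
      + x * (\<Sum>k = 1..r - 1. of_nat (falling_fact (n - 1) (k - 1)) * W r (n - k) x y)"
    by (simp add: z_def)
  \<comment> \<open>The last factor is \<open>(n - 1) - (r - 1) = n - r\<close>; it joins the weight
    \<open>y\<close> of the term \<open>k = r\<close> to give \<open>y + n - r\<close>.\<close>
  have "falling_fact (n - 1) r = falling_fact (n - 1) (r - 1) * (n - r)"
    using falling_fact_add[of "n - 1" "r - 1" 1] assms by (simp add: falling_fact_def)
  then have 2: "of_nat (falling_fact (n - 1) r)
      = (of_nat (falling_fact (n - 1) (r - 1)) * (of_nat n - of_nat r) :: 'a)"
    using assms by (simp add: of_nat_diff)
  have "W r n x y = (\<Sum>k = 1..r. ?t k) + of_nat (falling_fact (n - 1) r) * W r (n - r) x y"
    unfolding W by (rule cycle_sum_rec_periodic) (use assms in \<open>auto simp: z_def\<close>)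
  then show "W r n x y =
           x * (\<Sum>i = 1..r - 1. of_nat (falling_fact (n - 1) (i - 1)) * W r (n - i) x y)
           + (y + of_nat n - of_nat r) * of_nat (falling_fact (n - 1) (r - 1)) * W r (n - r) x y"
    unfolding 1 2 by (simp add: algebra_simps)
  show "\<forall>m \<le> r - 1. W r m x y = pochhammer x m"
  proof (intro allI impI)
    fix m assume "m \<le> r - 1"
    then show "W r m x y = pochhammer x m"
    proof (induction m)
      case 0
      then show ?case by (simp add: W_def)
    next
      case (Suc m)
      \<comment> \<open>Period 1: all lengths up to \<open>Suc m\<close> are below \<open>r\<close>,
        so every weight is \<open>x\<close>.\<close>
      have "W r (Suc m) x y = (\<Sum>k = 1..1. of_nat (falling_fact (Suc m - 1) (k - 1)) * z k * W r (Suc m - k) x y)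
          + of_nat (falling_fact (Suc m - 1) 1) * W r (Suc m - 1) x y"
        unfolding W by (rule cycle_sum_rec_periodic) (use Suc.prems z in auto)
      also have "\<dots> = (x + of_nat m) * W r m x y"
        using Suc.prems z[of 1] assms by (simp add: falling_fact_def algebra_simps)
      finally show ?case using Suc by (simp add: pochhammer_Suc mult.commute)
    qed
  qed
qed

end
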